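(* Suppose the convex loss $\rho$ is Lipschitz continuous with constant $L$, i.e. $|\rho(x)-\rho(y)|\le L|x-y|$ for all $x,y\in\mathbb R$. Let $B^0\in\arg\min_{B'\in\mathcal B}R(B')$ and suppose the one-point-margin condition holds: there is an increasing strictly convex function $G$ on $[0,\infty)$ with $G(0)=0$ such that for all $B'\in\mathcal B$ $$R(B')-R(B^0)\ \ge\ G(\|B'-B^0\|_F).$$ Let $H$ be the convex conjugate of $G$. Let $B\in\mathcal B$, let $1\le s\le q$ be an integer, and let $B^-$ and $\underline\Omega$ be defined from $B$ and $s$ as in the context. Suppose that for some $\lambda_\varepsilon>0$, $\lambda_*>0$ and all $B'\in\mathcal B$ $$\big|[R_n(B')-R(B')]-[R_n(B)-R(B)]\big|\ \le\ \lambda_\varepsilon\,\underline\Omega(B'-B)+\lambda_*.$$ Let $0<\delta<1$, take $\lambda>\lambda_\varepsilon$ and define $\overline\lambda=\lambda+\lambda_\varepsilon$, $\underline\lambda=\lambda-\lambda_\varepsilon$. Let $\hat B$ be a minimizer over $\mathcal B$ of $R_n(\cdot)+\lambda\|\cdot\|_{\rm nuclear}$. Then $$\delta\underline\lambda\,\underline\Omega(\hat B-B)\ \le\ 2H\big(3\overline\lambda(1+\delta)\sqrt s\big)+2\big(\lambda_*+R(B)-R(B^0)\big)+4\lambda\|B^-\|_{\rm nuclear}$$ and $$R(\hat B)-R(B)\ \le\ \frac1\delta\Big[2H\big(3\overline\lambda(1+\delta)\sqrt s\big)+\lambda_*+2\big(R(B)-R(B^0)\big)+2\lambda\|B^-\|_{\rm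 nuclear}\Big]+\lambda_*+2\lambda\|B^-\|_{\rm nuclear}.$$
   Context: Let $q\le p$, $\eta>0$ and $\mathcal B=\{B\in\mathbb R^{p\times q}:\|B\|_\infty\le\eta\}$, where $\|B\|_\infty$ is the largest absolute value of the entries. Observations $(X_i,Y_i)$, $i=1,\dots,n$, have $Y_i\in\mathbb R$ and $X_i\in\{e_k(q)e_l(p)^T:1\le k\le q,1\le l\le p\}$ ($q\times p$ matrices with one entry equal to 1 and the others 0). For a convex loss $\rho:\mathbb R\to\mathbb R$, the empirical risk is $R_n(B)=\frac1n\sum_{i=1}^n\rho(Y_i-\operatorname{trace}(X_iB))$ and the theoretical risk is $R(B)=\mathbb E R_n(B)$ (assumed finite). $\|\cdot\|_F$ is the Frobenius norm and $\|\cdot\|_{\rm nuclear}$ the sum of singular values. Convex conjugate: $H(v)=\sup_{u\ge0}\{uv-G(u)\}$ for $v\ge0$. Given $B$, write its singular value decomposition $B=P\Lambda Q^T$ with $P\in\mathbb R^{p\times q}$, $Q\in\mathbb R^{q\times q}$ having orthonormal columns $P_k$, $Q_k$, and $\Lambda=\mathrm{diag}(\Lambda_1\ge\dots\ge\Lambda_q\ge0)$. For the integer $s$ put $B^+=\sum_{k=1}^s\Lambda_kP_kQ_k^T$, $B^-=\sum_{k=s+1}^q\Lambda_kP_kQ_k^T$, $P^+=(P_1,\dots,P_s)$, $Q^+=(Q_1,\dots,Q_s)$. For $A\in\mathbb R^{p\times q}$ define $$\Omega^+(A)=\sqrt s\big(\|P^+P^{+T}A\|_F+\|AQ^+Q^{+T}\|_F+\|P^+P^{+T}AQ^+Q^{+T}\|_F\big),$$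 $$\Omega^-(A)=\|(I-P^+P^{+T})A(I-Q^+Q^{+T})\|_{\rm nuclear},\qquad \underline\Omega=\Omega^++\Omega^-.$$ *)

theory Defs
  imports "HOL-Probability.Probability"
begin

text \<open>
  A \<open>p \<times> q\<close> matrix has type \<open>real ^ 'q ^ 'p\<close>, with \<open>p = CARD('p)\<close> and \<open>q = CARD('q)\<close>.
  On this type \<open>norm\<close> is the Frobenius norm and \<open>infnorm\<close> is the largest absolute value of
  the entries.
\<close>

definition max_ball :: "real \<Rightarrow> (real ^ 'q ^ 'p) set" where
  "max_ball \<eta> = {B. infnorm B \<le> \<eta>}"

definition outer :: "real ^ 'm \<Rightarrow> real ^ 'n \<Rightarrow> real ^ 'n ^ 'm" where
  "outer u v = (\<chi> i j. u $ i * v $ j)"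

definition mask_set :: "(real ^ 'p ^ 'q) set" where
  "mask_set = {outer (axis k 1) (axis l 1) | k l. True}"


definition orthonormal_family :: "'i set \<Rightarrow> ('i \<Rightarrow> real ^ 'm) \<Rightarrow> bool" where
  "orthonormal_family I u \<longleftrightarrow> (\<forall>i\<in>I. \<forall>j\<in>I. u i \<bullet> u j = (if i = j then 1 else 0))"

text \<open>
  Singular values and singular vectors are indexed by \<open>1, \<dots>, q\<close>, because the index type
  \<open>'q\<close> carries no order; their values outside this range are irrelevant. Such
  a decomposition (with \<open>q\<close> left singular vectors in \<open>p\<close>-space) exists exactly when
  \<open>q \<le> p\<close>, so the nuclear norm below is meaningful only for such matrices.
  The singular values on \<open>1, \<dots>, q\<close> are uniquely determined by the matrix; the singular
  vectors are not.
\<close>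

definition is_svd ::
  "real ^ 'q ^ 'p \<Rightarrow> (nat \<Rightarrow> real ^ 'p) \<Rightarrow> (nat \<Rightarrow> real) \<Rightarrow> (nat \<Rightarrow> real ^ 'q) \<Rightarrow> bool" where
  "is_svd B P \<Lambda> Q \<longleftrightarrow>
     orthonormal_family {1..CARD('q)} P \<and>
     orthonormal_family {1..CARD('q)} Q \<and>
     antimono_on {1..CARD('q)} \<Lambda> \<and>
     (\<forall>k\<in>{1..CARD('q)}. 0 \<le> \<Lambda> k) \<and>
     B = (\<Sum>k=1..CARD('q). \<Lambda> k *\<^sub>R outer (P k) (Q k))"

definition singular_values :: "real ^ 'q ^ 'p \<Rightarrow> nat \<Rightarrow> real" where
  "singular_values A = (SOME \<Lambda>. \<exists>P Q. is_svd A P \<Lambda> Q)"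

definition nuclear_norm :: "real ^ 'q ^ 'p \<Rightarrow> real" where
  "nuclear_norm A = (\<Sum>k=1..CARD('q). singular_values A k)"

definition svd_tail ::
  "nat \<Rightarrow> (nat \<Rightarrow> real ^ 'p) \<Rightarrow> (nat \<Rightarrow> real) \<Rightarrow> (nat \<Rightarrow> real ^ 'q) \<Rightarrow> real ^ 'q ^ 'p" where
  "svd_tail s P \<Lambda> Q = (\<Sum>k=s+1..CARD('q). \<Lambda> k *\<^sub>R outer (P k) (Q k))"

text \<open>The matrix \<open>U U\<^sup>T\<close>, where \<open>U\<close> has the columns \<open>u 1, \<dots>, u s\<close>.\<close>

definition col_proj :: "nat \<Rightarrow> (nat \<Rightarrow> real ^ 'm) \<Rightarrow> real ^ 'm ^ 'm" where
  "col_proj s u = (\<Sum>k=1..s. outer (u k) (u k))"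

definition Omega_plus ::
  "nat \<Rightarrow> (nat \<Rightarrow> real ^ 'p) \<Rightarrow> (nat \<Rightarrow> real ^ 'q) \<Rightarrow> real ^ 'q ^ 'p \<Rightarrow> real" where
  "Omega_plus s P Q A = sqrt (real s) *
     (norm (col_proj s P ** A) + norm (A ** col_proj s Q)
        + norm (col_proj s P ** A ** col_proj s Q))"

definition Omega_minus ::
  "nat \<Rightarrow> (nat \<Rightarrow> real ^ 'p) \<Rightarrow> (nat \<Rightarrow> real ^ 'q) \<Rightarrow> real ^ 'q ^ 'p \<Rightarrow> real" where
  "Omega_minus s P Q A =
     nuclear_norm ((mat 1 - col_proj s P) ** A ** (mat 1 - col_proj s Q))"

definition Omega_under ::
  "nat \<Rightarrow> (nat \<Rightarrow> real ^ 'p) \<Rightarrow> (nat \<Rightarrow> real ^ 'q) \<Rightarrow> real ^ 'q ^ 'p \<Rightarrow> real" where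
  "Omega_under s P Q A = Omega_plus s P Q A + Omega_minus s P Q A"


definition empirical_risk ::
  "(real \<Rightarrow> real) \<Rightarrow> nat \<Rightarrow> (nat \<Rightarrow> 'w \<Rightarrow> real ^ 'p ^ 'q) \<Rightarrow> (nat \<Rightarrow> 'w \<Rightarrow> real)
     \<Rightarrow> 'w \<Rightarrow> real ^ 'q ^ 'p \<Rightarrow> real" where
  "empirical_risk \<rho> n X Y \<omega> B =
     (1 / real n) * (\<Sum>i=1..n. \<rho> (Y i \<omega> - trace (X i \<omega> ** B)))"

definition risk ::
  "'w measure \<Rightarrow> (real \<Rightarrow> real) \<Rightarrow> nat \<Rightarrow> (nat \<Rightarrow> 'w \<Rightarrow> real ^ 'p ^ 'q)
     \<Rightarrow> (nat \<Rightarrow> 'w \<Rightarrow> real) \<Rightarrow> real ^ 'q ^ 'p \<Rightarrow> real" where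
  "risk M \<rho> n X Y B = integral\<^sup>L M (\<lambda>\<omega>. empirical_risk \<rho> n X Y \<omega> B)"


definition strictly_convex_on :: "real set \<Rightarrow> (real \<Rightarrow> real) \<Rightarrow> bool" where
  "strictly_convex_on S f \<longleftrightarrow> convex S \<and>
     (\<forall>x\<in>S. \<forall>y\<in>S. \<forall>t. x \<noteq> y \<and> 0 < t \<and> t < 1 \<longrightarrow>
        f ((1 - t) * x + t * y) < (1 - t) * f x + t * f y)"

text \<open>
  The supremum is taken in the extended reals: it is infinite for large \<open>v\<close> when \<open>G\<close> grows
  at most linearly.
\<close>

definition convex_conjugate :: "(real \<Rightarrow> real) \<Rightarrow> real \<Rightarrow> ereal" where
  "convex_conjugate G v = (SUP u\<in>{0..}. ereal (u * v - G u))"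

end

theory Submission
  imports Defs
begin

text \<open>
  The nuclear norm is dual to the operator norm: it is the largest value of \<open>Z \<bullet> A\<close> over
  contractions \<open>Z\<close>. Duality gives the triangle property
  \<open>\<parallel>B\<parallel> - \<parallel>B'\<parallel> \<le> \<Omega>\<^sup>+(B' - B) - \<Omega>\<^sup>-(B' - B) + 2 \<parallel>B\<^sup>-\<parallel>\<close>. Inserting it and the noise bound
  into the basic inequality \<open>R\<^sub>n(Bhat) + \<lambda> \<parallel>Bhat\<parallel> \<le> R\<^sub>n(B) + \<lambda> \<parallel>B\<parallel>\<close> bounds the excess risk plus
  \<open>(\<lambda> - \<lambda>\<^sub>\<epsilon>) \<Omega>\<^sup>-\<close> by \<open>(\<lambda> + \<lambda>\<^sub>\<epsilon>) \<Omega>\<^sup>+\<close> plus remainders. Add \<open>\<delta> (\<lambda> + \<lambda>\<^sub>\<epsilon>) \<Omega>\<^sup>+\<close> to both sides; since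
  \<open>\<Omega>\<^sup>+\<close> is at most \<open>3 \<surd>s\<close> times the Frobenius norm, Young's inequality \<open>u v \<le> H v + G u\<close> at
  \<open>Bhat - B0\<close> and \<open>B - B0\<close> and the margin condition absorb the right-hand side. Adding the
  multiple of \<open>\<lambda> + \<lambda>\<^sub>\<epsilon>\<close>, not of \<open>\<lambda> - \<lambda>\<^sub>\<epsilon>\<close>, makes the resulting bound serve both claims.
\<close>

section \<open>Outer products and orthonormal families\<close>

lemma outer_mult_vec: "outer u v *v w = (v \<bullet> w) *\<^sub>R u"
  by (simp add: outer_def matrix_vector_mult_def inner_vec_def vec_eq_iff sum_distrib_right
      mult.assoc mult.commute[of "u $ _"])

lemma inner_outer: "outer u v \<bullet> A = u \<bullet> (A *v v)"
  by (simp add: outer_def matrix_vector_mult_def inner_vec_def sum_distrib_left mult_ac)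

lemma sum_matrix_vec_mult: "(\<Sum>i\<in>I. f i) *v x = (\<Sum>i\<in>I. f i *v x)"
  by (induction I rule: infinite_finite_induct)
    (simp_all add: matrix_vector_mult_add_rdistrib)

lemma orthonormal_family_subset:
  "orthonormal_family I u \<Longrightarrow> J \<subseteq> I \<Longrightarrow> orthonormal_family J u"
  unfolding orthonormal_family_def by blast

lemma orthonormal_family_inner:
  "orthonormal_family I u \<Longrightarrow> i \<in> I \<Longrightarrow> j \<in> I \<Longrightarrow> u i \<bullet> u j = (if i = j then 1 else 0)"
  by (simp add: orthonormal_family_def)

lemma orthonormal_family_inner_sum:
  assumes "orthonormal_family I u" "finite I" "i \<in> I"
  shows "u i \<bullet> (\<Sum>k\<in>I. c k *\<^sub>R u k) = c i"
proof -
  have "u i \<bullet> (\<Sum>k\<in>I. c k *\<^sub>R u k) = (\<Sum>k\<in>I. if i = k then c k else 0)"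
    unfolding inner_sum_right using assms by (intro sum.cong) (auto simp: orthonormal_family_def)
  then show ?thesis
    using assms by simp
qed

lemma norm_sum_orthonormal:
  assumes "orthonormal_family I u" "finite I"
  shows "(norm (\<Sum>k\<in>I. c k *\<^sub>R u k))\<^sup>2 = (\<Sum>k\<in>I. (c k)\<^sup>2)"
  unfolding power2_norm_eq_inner inner_sum_left
  by (intro sum.cong) (simp_all add: orthonormal_family_inner_sum[OF assms] power2_eq_square)

lemma orthonormal_pythagoras:
  assumes "orthonormal_family I u" "finite I"
  shows "(\<Sum>k\<in>I. (u k \<bullet> x)\<^sup>2) + (norm (x - (\<Sum>k\<in>I. (u k \<bullet> x) *\<^sub>R u k)))\<^sup>2 = (norm x)\<^sup>2"
proof -
  let ?y = "\<Sum>k\<in>I. (u k \<bullet> x) *\<^sub>R u k"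
  have "x \<bullet> ?y = (\<Sum>k\<in>I. (u k \<bullet> x)\<^sup>2)"
    by (simp add: inner_sum_right power2_eq_square inner_commute)
  moreover have "?y \<bullet> ?y = (\<Sum>k\<in>I. (u k \<bullet> x)\<^sup>2)"
    using norm_sum_orthonormal[OF assms] by (simp add: power2_norm_eq_inner)
  ultimately show ?thesis
    by (simp add: power2_norm_eq_inner inner_diff inner_commute)
qed

text \<open>By cardinality the family spans the space, so the residual, orthogonal to every
  \<open>u k\<close>, is orthogonal to itself.\<close>

lemma orthonormal_expansion:
  fixes u :: "nat \<Rightarrow> real ^ 'm"
  assumes "orthonormal_family I u" "finite I" "card I = CARD('m)"
  shows "x = (\<Sum>k\<in>I. (u k \<bullet> x) *\<^sub>R u k)"
proof -
  have inj: "inj_on u I"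
    using assms(1) by (auto simp: orthonormal_family_def inj_on_def) (metis zero_neq_one)
  have "0 \<notin> u ` I"
    using assms(1) by (fastforce simp: orthonormal_family_def)
  moreover have "pairwise orthogonal (u ` I)"
    using assms(1) by (auto simp: orthonormal_family_def pairwise_def orthogonal_def)
  ultimately have "independent (u ` I)"
    by (rule pairwise_orthogonal_independent[rotated])
  then have span: "span (u ` I) = UNIV"
    using card_ge_dim_independent[of "u ` I" UNIV] assms(3) card_image[OF inj] by auto
  let ?z = "x - (\<Sum>k\<in>I. (u k \<bullet> x) *\<^sub>R u k)"
  have "orthogonal ?z y" if "y \<in> u ` I" for y
    using that
    by (auto simp: orthogonal_def inner_diff_right inner_commute[of _ "u _"]
        orthonormal_family_inner_sum[OF assms(1,2)])
  then have "orthogonal ?z ?z"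
    using span by (intro orthogonal_to_span[of ?z "u ` I" ?z]) auto
  then show ?thesis
    by (simp add: orthogonal_self)
qed

section \<open>Projections and the Frobenius inner product\<close>

lemma col_proj_mult_vec: "col_proj s u *v x = (\<Sum>k=1..s. (u k \<bullet> x) *\<^sub>R u k)"
  by (simp add: col_proj_def sum_matrix_vec_mult outer_mult_vec)

lemma transpose_col_proj: "transpose (col_proj s u) = col_proj s u"
  by (simp add: col_proj_def transpose_def vec_eq_iff outer_def mult.commute)

lemma transpose_mat_1_minus_col_proj:
  "transpose (mat 1 - col_proj s u) = mat 1 - col_proj s u"
  using transpose_col_proj[of s u] by (simp add: transpose_def vec_eq_iff mat_def)

lemma matrix_mult_diff_distrib_both:
  fixes A B :: "real ^ 'n ^ 'm"
  shows "C ** (A - B) ** D = C ** A ** D - C ** B ** D"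
  by (simp add: matrix_eq matrix_vector_mult_diff_rdistrib matrix_vector_mult_diff_distrib
      flip: matrix_vector_mul_assoc)

text \<open>This adjointness later carries compressions from \<open>B'\<close> over to the test
  contraction.\<close>

lemma inner_matrix_mult_left:
  fixes A :: "real ^ 'q ^ 'p"
  shows "W \<bullet> (C ** A) = (transpose C ** W) \<bullet> A"
proof -
  have "W \<bullet> (C ** A) = (\<Sum>i\<in>UNIV. \<Sum>j\<in>UNIV. \<Sum>k\<in>UNIV. W $ i $ j * (C $ i $ k * A $ k $ j))"
    by (simp add: inner_vec_def matrix_matrix_mult_def sum_distrib_left)
  also have "\<dots> = (\<Sum>k\<in>UNIV. \<Sum>j\<in>UNIV. \<Sum>i\<in>UNIV. W $ i $ j * (C $ i $ k * A $ k $ j))"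
    by (subst (2) sum.swap, subst sum.swap, subst (2) sum.swap) simp
  also have "\<dots> = (transpose C ** W) \<bullet> A"
    by (simp add: inner_vec_def matrix_matrix_mult_def transpose_def sum_distrib_left
        sum_distrib_right mult_ac)
  finally show ?thesis .
qed

lemma inner_transpose: "transpose A \<bullet> transpose B = A \<bullet> (B :: real ^ 'q ^ 'p)"
  unfolding inner_vec_def transpose_def by simp (rule sum.swap)

lemma norm_transpose: "norm (transpose A) = norm (A :: real ^ 'q ^ 'p)"
  by (simp add: norm_eq_sqrt_inner inner_transpose)

lemma inner_matrix_mult_right:
  fixes A :: "real ^ 'q ^ 'p"
  shows "W \<bullet> (A ** D) = (W ** transpose D) \<bullet> A"
  by (subst (1 2) inner_transpose[symmetric])
    (simp add: matrix_transpose_mul inner_matrix_mult_left)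

text \<open>The projection is symmetric, so it acts on each row of \<open>A\<close> separately, and
  the Frobenius norm is the L2 norm of the row norms.\<close>

lemma norm_mult_col_proj_right_le:
  assumes "orthonormal_family {1..s} u"
  shows "norm (A ** col_proj s u) \<le> norm A"
proof -
  have "norm ((A ** col_proj s u) $ i) \<le> norm (A $ i)" for i
  proof -
    have "(A ** col_proj s u) $ i = col_proj s u *v (A $ i)"
      by (subst transpose_col_proj[symmetric])
        (simp add: vec_eq_iff matrix_matrix_mult_def matrix_vector_mult_def transpose_def mult.commute)
    moreover have "(norm (col_proj s u *v (A $ i)))\<^sup>2 \<le> (norm (A $ i))\<^sup>2"
      using orthonormal_pythagoras[OF assms, of "A $ i"] norm_sum_orthonormal[OF assms]
      by (simp add: col_proj_mult_vec) (smt (verit) zero_le_power2)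
    ultimately show ?thesis
      by simp
  qed
  then show ?thesis
    by (simp add: norm_vec_def L2_set_mono)
qed

lemma norm_mult_col_proj_left_le:
  assumes "orthonormal_family {1..s} u"
  shows "norm (col_proj s u ** A) \<le> norm A"
  using norm_mult_col_proj_right_le[OF assms, of "transpose A"]
  by (metis matrix_transpose_mul norm_transpose transpose_col_proj transpose_transpose)

lemma Omega_plus_le:
  assumes "orthonormal_family {1..s} P" "orthonormal_family {1..s} Q"
  shows "Omega_plus s P Q A \<le> 3 * sqrt (real s) * norm A"
proof -
  have "norm (col_proj s P ** A) + norm (A ** col_proj s Q)
        + norm (col_proj s P ** A ** col_proj s Q) \<le> 3 * norm A"
    using norm_mult_col_proj_left_le[OF assms(1), of A] norm_mult_col_proj_right_le[OF assms(2), of A]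
      norm_mult_col_proj_right_le[OF assms(2), of "col_proj s P ** A"] by linarith
  from mult_left_mono[OF this, of "sqrt (real s)"] show ?thesis
    by (simp add: Omega_plus_def mult_ac)
qed

section \<open>Contractions and partial isometries\<close>

definition contractive :: "real ^ 'q ^ 'p \<Rightarrow> bool" where
  "contractive Z \<longleftrightarrow> (\<forall>u v. u \<bullet> (Z *v v) \<le> norm u * norm v)"

text \<open>For \<open>I = {1..s}\<close> this is \<open>P\<^sup>+ (Q\<^sup>+)\<^sup>T\<close>; over
  all indices of a decomposition it attains the nuclear norm.\<close>

definition partial_isometry ::
  "nat set \<Rightarrow> (nat \<Rightarrow> real ^ 'p) \<Rightarrow> (nat \<Rightarrow> real ^ 'q) \<Rightarrow> real ^ 'q ^ 'p" where
  "partial_isometry I P Q = (\<Sum>k\<in>I. outer (P k) (Q k))"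

text \<open>The outer products are orthonormal for the Frobenius inner product. Separate index sets
  let the leading block be paired with all of \<open>B\<close>.\<close>

lemma inner_partial_isometry:
  assumes "orthonormal_family I P" "orthonormal_family I Q" "finite I" "J \<subseteq> I" "K \<subseteq> I"
  shows "partial_isometry J P Q \<bullet> (\<Sum>k\<in>K. c k *\<^sub>R outer (P k) (Q k)) = (\<Sum>k\<in>J \<inter> K. c k)"
proof -
  have fin: "finite J" "finite K"
    using assms finite_subset by auto
  have "outer (P j) (Q j) \<bullet> outer (P k) (Q k) = (if j = k then 1 else 0)" if "j \<in> J" "k \<in> K" for j k
  proof -
    have "j \<in> I" "k \<in> I"
      using that assms by auto
    then show ?thesis
      by (simp add: inner_outer outer_mult_vec orthonormal_family_inner[OF assms(1)]
          orthonormal_family_inner[OF assms(2)])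
  qed
  then have "partial_isometry J P Q \<bullet> (\<Sum>k\<in>K. c k *\<^sub>R outer (P k) (Q k))
      = (\<Sum>k\<in>K. \<Sum>j\<in>J. if j = k then c k else 0)"
    unfolding partial_isometry_def inner_sum_left inner_sum_right
    by (intro sum.cong) auto
  then show ?thesis
    using fin by (simp add: sum.inter_restrict Int_commute[of J])
qed

text \<open>Stopping at the coefficient sums leaves room in \<open>contractive_block_sum\<close> for
  the components outside the spans.\<close>

lemma inner_partial_isometry_mult_le:
  assumes "orthonormal_family I P" "orthonormal_family I Q" "finite I"
  shows "u \<bullet> (partial_isometry I P Q *v v)
    \<le> sqrt (\<Sum>k\<in>I. (P k \<bullet> u)\<^sup>2) * sqrt (\<Sum>k\<in>I. (Q k \<bullet> v)\<^sup>2)"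
proof -
  have "u \<bullet> (partial_isometry I P Q *v v) = (\<Sum>k\<in>I. (P k \<bullet> u) * (Q k \<bullet> v))"
    by (simp add: partial_isometry_def sum_matrix_vec_mult outer_mult_vec inner_sum_right
        inner_commute mult.commute)
  also have "\<dots> \<le> (\<Sum>k\<in>I. \<bar>P k \<bullet> u\<bar> * \<bar>Q k \<bullet> v\<bar>)"
    by (intro sum_mono) (metis abs_ge_self abs_mult)
  also have "\<dots> \<le> L2_set (\<lambda>k. P k \<bullet> u) I * L2_set (\<lambda>k. Q k \<bullet> v) I"
    by (rule L2_set_mult_ineq)
  finally show ?thesis
    by (simp add: L2_set_def)
qed

text \<open>Cauchy--Schwarz in the plane, applied to the norms of the components of \<open>u\<close> and \<open>v\<close>
  inside and outside the two spans.\<close>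
lemma contractive_block_sum:
  assumes P: "orthonormal_family {1..s} P" and Q: "orthonormal_family {1..s} Q"
    and W: "contractive W"
  shows "contractive (partial_isometry {1..s} P Q
    + (mat 1 - col_proj s P) ** W ** (mat 1 - col_proj s Q))"
  unfolding contractive_def
proof (intro allI)
  fix u v
  let ?u = "u - col_proj s P *v u" and ?v = "v - col_proj s Q *v v"
  define a b where "a = sqrt (\<Sum>k=1..s. (P k \<bullet> u)\<^sup>2)" and "b = sqrt (\<Sum>k=1..s. (Q k \<bullet> v)\<^sup>2)"
  have "u \<bullet> (((mat 1 - col_proj s P) ** W ** (mat 1 - col_proj s Q)) *v v)
      = (transpose (mat 1 - col_proj s P) *v u) \<bullet> (W *v ((mat 1 - col_proj s Q) *v v))"
    by (simp add: dot_lmul_matrix[symmetric] matrix_vector_mul_assoc[symmetric])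
  also have "\<dots> = ?u \<bullet> (W *v ?v)"
    by (simp only: transpose_mat_1_minus_col_proj)
      (simp add: matrix_vector_mult_diff_rdistrib)
  also have "\<dots> \<le> norm ?u * norm ?v"
    using W by (simp add: contractive_def)
  finally have *: "u \<bullet> (((mat 1 - col_proj s P) ** W ** (mat 1 - col_proj s Q)) *v v)
    \<le> norm ?u * norm ?v" .
  have "a * b + norm ?u * norm ?v = (a, norm ?u) \<bullet> (b, norm ?v)"
    by (simp add: inner_prod_def)
  also have "\<dots> \<le> norm (a, norm ?u) * norm (b, norm ?v)"
    by (rule norm_cauchy_schwarz)
  also have "\<dots> = norm u * norm v"
    using orthonormal_pythagoras[OF P, of u] orthonormal_pythagoras[OF Q, of v]
    by (simp add: norm_prod_def a_def b_def col_proj_mult_vec sum_nonneg)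
  finally show "u \<bullet> ((partial_isometry {1..s} P Q
      + (mat 1 - col_proj s P) ** W ** (mat 1 - col_proj s Q)) *v v) \<le> norm u * norm v"
    using * inner_partial_isometry_mult_le[OF P Q, of u v]
    by (simp add: matrix_vector_mult_add_rdistrib inner_add_right a_def b_def)
qed

lemma contractive_partial_isometry:
  assumes "orthonormal_family I P" "orthonormal_family I Q" "finite I"
  shows "contractive (partial_isometry I P Q)"
  unfolding contractive_def
proof (intro allI)
  fix u v
  have "sqrt (\<Sum>k\<in>I. (P k \<bullet> u)\<^sup>2) \<le> norm u"
    using orthonormal_pythagoras[OF assms(1,3), of u]
    by (intro real_le_lsqrt norm_ge_zero) (smt (verit) zero_le_power2)
  moreover have "sqrt (\<Sum>k\<in>I. (Q k \<bullet> v)\<^sup>2) \<le> norm v"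
    using orthonormal_pythagoras[OF assms(2,3), of v]
    by (intro real_le_lsqrt norm_ge_zero) (smt (verit) zero_le_power2)
  ultimately have "sqrt (\<Sum>k\<in>I. (P k \<bullet> u)\<^sup>2) * sqrt (\<Sum>k\<in>I. (Q k \<bullet> v)\<^sup>2) \<le> norm u * norm v"
    by (intro mult_mono) (auto simp: sum_nonneg)
  then show "u \<bullet> (partial_isometry I P Q *v v) \<le> norm u * norm v"
    using inner_partial_isometry_mult_le[OF assms, of u v] by linarith
qed

text \<open>Upper half of the duality, for any decomposition: each \<Lambda> \<open>k\<close> is
  weighted by a value of \<open>Z\<close> at a pair of unit vectors.\<close>

lemma contractive_inner_le:
  fixes A :: "real ^ 'q ^ 'p"
  assumes Z: "contractive Z" and A: "is_svd A P \<Lambda> Q"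
  shows "Z \<bullet> A \<le> (\<Sum>k=1..CARD('q). \<Lambda> k)"
proof -
  have "Z \<bullet> A = (\<Sum>k=1..CARD('q). \<Lambda> k * (P k \<bullet> (Z *v Q k)))"
    using A by (simp add: is_svd_def inner_sum_right inner_commute[of Z "outer _ _"] inner_outer)
  also have "\<dots> \<le> (\<Sum>k=1..CARD('q). \<Lambda> k * 1)"
  proof (intro sum_mono mult_left_mono)
    fix k assume k: "k \<in> {1..CARD('q)}"
    have "P k \<bullet> (Z *v Q k) \<le> norm (P k) * norm (Q k)"
      using Z by (simp add: contractive_def)
    then show "P k \<bullet> (Z *v Q k) \<le> 1"
      using A k by (simp add: is_svd_def orthonormal_family_def norm_eq_sqrt_inner)
  qed (use A in \<open>auto simp: is_svd_def\<close>)
  finally show ?thesis by simp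
qed

lemma inner_partial_isometry_svd:
  fixes A :: "real ^ 'q ^ 'p"
  assumes "is_svd A P \<Lambda> Q"
  shows "partial_isometry {1..CARD('q)} P Q \<bullet> A = (\<Sum>k=1..CARD('q). \<Lambda> k)"
  using assms inner_partial_isometry[of "{1..CARD('q)}" P Q "{1..CARD('q)}" "{1..CARD('q)}" \<Lambda>]
  by (simp add: is_svd_def)

section \<open>Existence of the singular value decomposition\<close>

lemma eq_scaleR_if_inner_eq_norm_bound:
  fixes u x :: "'a::real_inner"
  assumes "norm u = 1" "u \<bullet> x = \<sigma>" "norm x \<le> \<sigma>"
  shows "x = \<sigma> *\<^sub>R u"
proof -
  have "(norm x)\<^sup>2 \<le> \<sigma>\<^sup>2"
    using assms by (intro power_mono) auto
  \<comment> \<open>Equality case of Cauchy-Schwarz: the right-hand side reduces to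
    \<open>(norm x)\<^sup>2 - \<sigma>\<^sup>2\<close>.\<close>
  moreover have "(norm (x - \<sigma> *\<^sub>R u))\<^sup>2 = (norm x)\<^sup>2 - 2 * \<sigma> * (u \<bullet> x) + \<sigma>\<^sup>2 * (norm u)\<^sup>2"
    by (simp only: power2_norm_eq_inner)
      (simp add: inner_diff inner_commute algebra_simps power2_eq_square)
  ultimately have "(norm (x - \<sigma> *\<^sub>R u))\<^sup>2 \<le> 0"
    using assms by (simp add: power2_eq_square)
  then show ?thesis by simp
qed

definition unit_orthogonal :: "nat \<Rightarrow> (nat \<Rightarrow> real ^ 'm) \<Rightarrow> (real ^ 'm) set" where
  "unit_orthogonal k u = {x. norm x = 1 \<and> (\<forall>i\<in>{1..k}. u i \<bullet> x = 0)}"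

lemma unit_orthogonal_nonempty:
  fixes u :: "nat \<Rightarrow> real ^ 'm"
  assumes "k < CARD('m)"
  shows "unit_orthogonal k u \<noteq> {}"
proof -
  have "dim (u ` {1..k}) \<le> card (u ` {1..k})"
    by (intro dim_le_card') auto
  also have "\<dots> \<le> k"
    using card_image_le[of "{1..k}" u] by simp
  finally have "dim (u ` {1..k}) < DIM(real ^ 'm)"
    using assms by simp
  then obtain x where "x \<noteq> 0" and x: "\<And>y. y \<in> span (u ` {1..k}) \<Longrightarrow> orthogonal x y"
    using orthogonal_to_subspace_exists by metis
  then have "(1 / norm x) *\<^sub>R x \<in> unit_orthogonal k u"
    using x[OF span_base] by (auto simp: unit_orthogonal_def orthogonal_def inner_commute[of x])
  then show ?thesis by blast
qed

lemma compact_unit_orthogonal: "compact (unit_orthogonal k u)"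
proof -
  have "unit_orthogonal k u = sphere 0 1 \<inter> (\<Inter>i\<in>{1..k}. {x. u i \<bullet> x = 0})"
    by (auto simp: unit_orthogonal_def)
  then show ?thesis
    by (simp add: compact_Int_closed closed_INT closed_hyperplane)
qed

lemma normalize_unit_orthogonal:
  assumes "x \<noteq> 0" "\<And>i. i \<in> {1..k} \<Longrightarrow> u i \<bullet> x = 0"
  shows "(1 / norm x) *\<^sub>R x \<in> unit_orthogonal k u"
  using assms by (simp add: unit_orthogonal_def)

lemma orthonormal_family_extend:
  assumes "orthonormal_family {1..k} u" "x \<in> unit_orthogonal k u"
  shows "orthonormal_family {1..Suc k} (u(Suc k := x))"
  using assms
  by (auto simp: orthonormal_family_def unit_orthogonal_def norm_eq_1 inner_commute le_Suc_eq)

text \<open>The feasible sets shrink, so the maximum of one stage bounds the form on the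
  next.\<close>

lemma unit_orthogonal_extend: "unit_orthogonal (Suc k) (u(Suc k := x)) \<subseteq> unit_orthogonal k u"
proof
  fix y assume y: "y \<in> unit_orthogonal (Suc k) (u(Suc k := x))"
  have "u i \<bullet> y = 0" if "i \<in> {1..k}" for i
  proof -
    have "i \<in> {1..Suc k}" "i \<noteq> Suc k"
      using that by auto
    then show ?thesis
      using y unfolding unit_orthogonal_def by fastforce
  qed
  then show "y \<in> unit_orthogonal k u"
    using y by (simp add: unit_orthogonal_def)
qed

lemma inner_mult_vec_transpose: "(u :: real ^ 'p) \<bullet> (A *v v) = v \<bullet> (transpose A *v u)"
  by (metis dot_lmul_matrix inner_commute transpose_matrix_vector)

text \<open>The next singular pair maximises the bilinear form \<open>u \<bullet> (A *v v)\<close> over unit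
  vectors orthogonal to the previous pairs; the last conjunct keeps the singular values decreasing.\<close>
lemma partial_svd_exists:
  fixes A :: "real ^ 'q ^ 'p"
  assumes dims: "CARD('q) \<le> CARD('p)" and "k \<le> CARD('q)"
  shows "\<exists>P \<Lambda> Q. orthonormal_family {1..k} P \<and> orthonormal_family {1..k} Q \<and>
    antimono_on {1..k} \<Lambda> \<and> (\<forall>i\<in>{1..k}. 0 \<le> \<Lambda> i) \<and>
    (\<forall>i\<in>{1..k}. A *v Q i = \<Lambda> i *\<^sub>R P i \<and> transpose A *v P i = \<Lambda> i *\<^sub>R Q i) \<and>
    (0 < k \<longrightarrow> (\<forall>u\<in>unit_orthogonal k P. \<forall>v\<in>unit_orthogonal k Q. u \<bullet> (A *v v) \<le> \<Lambda> k))"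
  using assms(2)
proof (induction k)
  case 0
  show ?case
    by (auto simp: orthonormal_family_def monotone_on_def)
next
  case (Suc k)
  then obtain P \<Lambda> Q where P: "orthonormal_family {1..k} P" and Q: "orthonormal_family {1..k} Q"
    and anti: "antimono_on {1..k} \<Lambda>" and nonneg: "\<And>i. i \<in> {1..k} \<Longrightarrow> 0 \<le> \<Lambda> i"
    and AQ: "\<And>i. i \<in> {1..k} \<Longrightarrow> A *v Q i = \<Lambda> i *\<^sub>R P i"
    and AP: "\<And>i. i \<in> {1..k} \<Longrightarrow> transpose A *v P i = \<Lambda> i *\<^sub>R Q i"
    and bound: "\<And>u v. 0 < k \<Longrightarrow> u \<in> unit_orthogonal k P \<Longrightarrow> v \<in> unit_orthogonal k Q
      \<Longrightarrow> u \<bullet> (A *v v) \<le> \<Lambda> k"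
    by auto
  let ?S = "unit_orthogonal k P \<times> unit_orthogonal k Q"
  have "compact ?S"
    by (intro compact_Times compact_unit_orthogonal)
  \<comment> \<open>Here \<open>k < CARD('q) \<le> CARD('p)\<close> leaves a free direction on both
    sides.\<close>
  moreover have "?S \<noteq> {}"
    using unit_orthogonal_nonempty[of k P] unit_orthogonal_nonempty[of k Q] Suc.prems dims by auto
  moreover have "continuous_on ?S (\<lambda>(u, v). u \<bullet> (A *v v))"
    unfolding split_def
    by (intro continuous_intros continuous_on_compose2[OF matrix_vector_mult_linear_continuous_on]) auto
  ultimately obtain z where "z \<in> ?S"
    "\<forall>z'\<in>?S. (case z' of (u, v) \<Rightarrow> u \<bullet> (A *v v)) \<le> (case z of (u, v) \<Rightarrow> u \<bullet> (A *v v))"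
    using continuous_attains_sup by blast
  then obtain u v where u: "u \<in> unit_orthogonal k P" and v: "v \<in> unit_orthogonal k Q"
    and max: "\<And>u' v'. u' \<in> unit_orthogonal k P \<Longrightarrow> v' \<in> unit_orthogonal k Q
      \<Longrightarrow> u' \<bullet> (A *v v') \<le> u \<bullet> (A *v v)"
    by (cases z) auto
  define \<sigma> where "\<sigma> = u \<bullet> (A *v v)"
  \<comment> \<open>Flipping the sign of \<open>u\<close> negates the form, so its maximum cannot be
    negative.\<close>
  have "- u \<in> unit_orthogonal k P"
    using u by (simp add: unit_orthogonal_def)
  from max[OF this v] have \<sigma>: "0 \<le> \<sigma>"
    by (simp add: \<sigma>_def)
  \<comment> \<open>The pair \<open>u\<close>, \<open>v\<close> was covered by the bound of the
    previous stage.\<close>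
  have \<sigma>_le: "\<sigma> \<le> \<Lambda> i" if "i \<in> {1..k}" for i
  proof -
    have "\<Lambda> k \<le> \<Lambda> i"
      using anti that by (auto simp: monotone_on_def)
    then show ?thesis
      using bound[OF _ u v] that by (simp add: \<sigma>_def)
  qed
  have Av: "A *v v = \<sigma> *\<^sub>R u"
  proof (rule eq_scaleR_if_inner_eq_norm_bound)
    show "norm (A *v v) \<le> \<sigma>"
    proof (cases "A *v v = 0")
      case False
      \<comment> \<open>Since \<open>transpose A\<close> sends \<open>P i\<close> to a multiple of
        \<open>Q i\<close>, orthogonal to \<open>v\<close>, the normalised image of \<open>v\<close>
        competes with \<open>u\<close>; maximality then bounds its norm.\<close>
      have "P i \<bullet> (A *v v) = 0" if "i \<in> {1..k}" for i
        using that v AP by (simp add: inner_mult_vec_transpose[of "P i"] unit_orthogonal_def inner_commute)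
      from max[OF normalize_unit_orthogonal[OF False this] v] show ?thesis
        using False by (simp add: \<sigma>_def dot_square_norm power2_eq_square)
    qed (use \<sigma> in simp)
  qed (use u in \<open>auto simp: \<sigma>_def unit_orthogonal_def\<close>)
  have Au: "transpose A *v u = \<sigma> *\<^sub>R v"
  proof (rule eq_scaleR_if_inner_eq_norm_bound)
    show "norm (transpose A *v u) \<le> \<sigma>"
    proof (cases "transpose A *v u = 0")
      case False
      have "Q i \<bullet> (transpose A *v u) = 0" if "i \<in> {1..k}" for i
        using that u AQ
        by (simp add: inner_mult_vec_transpose[of u, symmetric] unit_orthogonal_def
            inner_commute[of u] del: transpose_matrix_vector)
      from max[OF u normalize_unit_orthogonal[OF False this]] show ?thesis
        using False
        by (simp add: \<sigma>_def inner_mult_vec_transpose[of u] dot_square_norm power2_eq_square)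
    qed (use \<sigma> in simp)
  qed (use v in \<open>auto simp: \<sigma>_def unit_orthogonal_def inner_mult_vec_transpose[of u]\<close>)
  let ?P = "P(Suc k := u)" and ?\<Lambda> = "\<Lambda>(Suc k := \<sigma>)" and ?Q = "Q(Suc k := v)"
  have "orthonormal_family {1..Suc k} ?P" "orthonormal_family {1..Suc k} ?Q"
    using orthonormal_family_extend P Q u v by blast+
  moreover have "antimono_on {1..Suc k} ?\<Lambda>"
    using anti \<sigma>_le by (auto simp: monotone_on_def le_Suc_eq)
  moreover have "\<forall>i\<in>{1..Suc k}. 0 \<le> ?\<Lambda> i"
    using nonneg \<sigma> by auto
  moreover have "\<forall>i\<in>{1..Suc k}. A *v ?Q i = ?\<Lambda> i *\<^sub>R ?P i \<and> transpose A *v ?P i = ?\<Lambda> i *\<^sub>R ?Q i"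
    using AQ AP Av Au by auto
  moreover have "\<forall>x\<in>unit_orthogonal (Suc k) ?P. \<forall>y\<in>unit_orthogonal (Suc k) ?Q. x \<bullet> (A *v y) \<le> ?\<Lambda> (Suc k)"
    using max unit_orthogonal_extend[of k P u] unit_orthogonal_extend[of k Q v]
    by (auto simp: \<sigma>_def)
  ultimately show ?case
    by blast
qed

text \<open>After \<open>CARD('q)\<close> stages the right vectors form an orthonormal basis, and
  expanding \<open>x\<close> in it determines \<open>A *v x\<close>.\<close>

lemma svd_exists:
  fixes A :: "real ^ 'q ^ 'p"
  assumes "CARD('q) \<le> CARD('p)"
  shows "\<exists>P \<Lambda> Q. is_svd A P \<Lambda> Q"
proof -
  let ?I = "{1..CARD('q)}"
  obtain P \<Lambda> Q where svd: "orthonormal_family ?I P" "orthonormal_family ?I Q"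
    "antimono_on ?I \<Lambda>" "\<forall>i\<in>?I. 0 \<le> \<Lambda> i" and AQ: "\<forall>i\<in>?I. A *v Q i = \<Lambda> i *\<^sub>R P i"
    using partial_svd_exists[OF assms order_refl, of A] by blast
  have "A *v x = (\<Sum>k\<in>?I. \<Lambda> k *\<^sub>R outer (P k) (Q k)) *v x" for x
  proof -
    have "A *v x = A *v (\<Sum>k\<in>?I. (Q k \<bullet> x) *\<^sub>R Q k)"
      using orthonormal_expansion[OF svd(2), of x] by simp
    also have "\<dots> = (\<Sum>k\<in>?I. (Q k \<bullet> x) *\<^sub>R (\<Lambda> k *\<^sub>R P k))"
      using AQ by (simp add: linear_sum[OF matrix_vector_mul_linear] matrix_vector_mult_scaleR)
    finally show ?thesis
      by (simp add: sum_matrix_vec_mult outer_mult_vec scaleR_matrix_vector_assoc[symmetric] mult.commute)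
  qed
  then have "A = (\<Sum>k\<in>?I. \<Lambda> k *\<^sub>R outer (P k) (Q k))"
    by (subst matrix_eq) blast
  with svd show ?thesis
    unfolding is_svd_def by blast
qed

section \<open>Duality for the nuclear norm\<close>

lemma nuclear_norm_svd:
  fixes A :: "real ^ 'q ^ 'p"
  assumes "CARD('q) \<le> CARD('p)"
  obtains P \<Lambda> Q where "is_svd A P \<Lambda> Q" "nuclear_norm A = (\<Sum>k=1..CARD('q). \<Lambda> k)"
proof -
  have "\<exists>\<Lambda> P Q. is_svd A P \<Lambda> Q"
    using svd_exists[OF assms] by blast
  \<comment> \<open>Existence makes the choice in \<open>singular_values\<close> belong to a genuine
    decomposition.\<close>
  then have "\<exists>P Q. is_svd A P (singular_values A) Q"
    unfolding singular_values_def by (rule someI_ex)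
  then show ?thesis
    using that by (auto simp: nuclear_norm_def)
qed

lemma inner_le_nuclear_norm:
  fixes A :: "real ^ 'q ^ 'p"
  assumes "CARD('q) \<le> CARD('p)" "contractive Z"
  shows "Z \<bullet> A \<le> nuclear_norm A"
  using nuclear_norm_svd[OF assms(1)] contractive_inner_le[OF assms(2)] by metis

lemma nuclear_norm_attained:
  fixes A :: "real ^ 'q ^ 'p"
  assumes "CARD('q) \<le> CARD('p)"
  obtains W where "contractive W" "W \<bullet> A = nuclear_norm A"
proof -
  obtain P \<Lambda> Q where svd: "is_svd A P \<Lambda> Q" "nuclear_norm A = (\<Sum>k=1..CARD('q). \<Lambda> k)"
    using nuclear_norm_svd[OF assms] .
  have "contractive (partial_isometry {1..CARD('q)} P Q)"
    using svd by (intro contractive_partial_isometry) (auto simp: is_svd_def)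
  then show ?thesis
    using that inner_partial_isometry_svd[OF svd(1)] svd(2) by metis
qed

text \<open>Links the chosen singular values to a given decomposition: the contraction attaining the
  norm is evaluated in the latter.\<close>

lemma nuclear_norm_le_svd_sum:
  fixes A :: "real ^ 'q ^ 'p"
  assumes "CARD('q) \<le> CARD('p)" "is_svd A P \<Lambda> Q"
  shows "nuclear_norm A \<le> (\<Sum>k=1..CARD('q). \<Lambda> k)"
  using nuclear_norm_attained[OF assms(1)] contractive_inner_le[OF _ assms(2)] by metis

lemma nuclear_norm_nonneg:
  fixes A :: "real ^ 'q ^ 'p"
  assumes "CARD('q) \<le> CARD('p)"
  shows "0 \<le> nuclear_norm A"
  using inner_le_nuclear_norm[OF assms, of 0 A] by (simp add: contractive_def)

section \<open>The triangle property of the nuclear norm\<close>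

lemma inner_partial_isometry_le_norm:
  assumes P: "orthonormal_family {1..s} P" and Q: "orthonormal_family {1..s} Q"
  shows "\<bar>partial_isometry {1..s} P Q \<bullet> A\<bar> \<le> sqrt (real s) * norm (col_proj s P ** A ** col_proj s Q)"
proof -
  let ?E = "partial_isometry {1..s} P Q"
  have "(norm ?E)\<^sup>2 = real s"
    using inner_partial_isometry[OF P Q, of "{1..s}" "{1..s}" "\<lambda>_. 1"]
    by (simp add: power2_norm_eq_inner partial_isometry_def)
  then have norm_E: "norm ?E = sqrt (real s)"
    by (metis norm_ge_zero real_sqrt_unique)
  \<comment> \<open>The projections fix \<open>P k\<close> and \<open>Q k\<close>, so compressing
    \<open>A\<close> before Cauchy-Schwarz costs nothing.\<close>
  have "outer (P k) (Q k) \<bullet> (col_proj s P ** A ** col_proj s Q) = outer (P k) (Q k) \<bullet> A"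
    if k: "k \<in> {1..s}" for k
  proof -
    have fix_P: "col_proj s P *v P k = P k" and fix_Q: "col_proj s Q *v Q k = Q k"
      using k P Q by (simp_all add: col_proj_mult_vec orthonormal_family_def if_distribR
          if_distrib[of "\<lambda>c. c *\<^sub>R _"] cong: if_cong)
    have "outer (P k) (Q k) \<bullet> (col_proj s P ** A ** col_proj s Q)
        = (transpose (col_proj s P) *v P k) \<bullet> (A *v (col_proj s Q *v Q k))"
      by (metis dot_lmul_matrix inner_outer matrix_vector_mul_assoc transpose_matrix_vector)
    then show ?thesis
      by (simp add: transpose_col_proj fix_P fix_Q inner_outer)
  qed
  then have "?E \<bullet> (col_proj s P ** A ** col_proj s Q) = ?E \<bullet> A"
    by (simp add: partial_isometry_def inner_sum_left)
  then show ?thesis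
    using Cauchy_Schwarz_ineq2[of ?E "col_proj s P ** A ** col_proj s Q"] norm_E by simp
qed

text \<open>Test the nuclear norm of \<open>B'\<close> against \<open>P\<^sup>+ (Q\<^sup>+)\<^sup>T\<close> plus a contraction attaining
  \<open>Omega_minus\<close>, compressed to the orthogonal complements.\<close>
lemma nuclear_norm_diff_le:
  fixes B B' :: "real ^ 'q ^ 'p"
  assumes dims: "CARD('q) \<le> CARD('p)" and s: "s \<le> CARD('q)" and svd: "is_svd B P \<Lambda> Q"
  shows "nuclear_norm B - nuclear_norm B'
    \<le> Omega_plus s P Q (B' - B) - Omega_minus s P Q (B' - B) + 2 * nuclear_norm (svd_tail s P \<Lambda> Q)"
proof -
  let ?q = "CARD('q)"
  let ?C = "mat 1 - col_proj s P" and ?D = "mat 1 - col_proj s Q"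
  let ?E = "partial_isometry {1..s} P Q" and ?tail = "svd_tail s P \<Lambda> Q"
  have PQ: "orthonormal_family {1..?q} P" "orthonormal_family {1..?q} Q"
    and B: "B = (\<Sum>k=1..?q. \<Lambda> k *\<^sub>R outer (P k) (Q k))"
    using svd by (auto simp: is_svd_def)
  then have PQs: "orthonormal_family {1..s} P" "orthonormal_family {1..s} Q"
    using s by (auto intro: orthonormal_family_subset)
  have split: "{1..?q} = {1..s} \<union> {s+1..?q}" "{1..s} \<inter> {s+1..?q} = {}"
    using s by auto
  have sum_split: "(\<Sum>k=1..?q. f k) = (\<Sum>k=1..s. f k) + (\<Sum>k=s+1..?q. f k)"
    for f :: "nat \<Rightarrow> 'x::comm_monoid_add"
    unfolding split(1) by (rule sum.union_disjoint) (use split(2) in auto)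
  obtain W where W: "contractive W" "W \<bullet> (?C ** (B' - B) ** ?D) = Omega_minus s P Q (B' - B)"
    using nuclear_norm_attained[OF dims] unfolding Omega_minus_def by metis
  \<comment> \<open>The right complement kills the first \<open>s\<close> terms of \<open>B\<close>;
    the left one fixes the others.\<close>
  have block: "?C ** B ** ?D = ?tail"
  proof (subst matrix_eq, rule allI)
    fix x
    have fixed: "?D *v x = x - (\<Sum>k=1..s. (Q k \<bullet> x) *\<^sub>R Q k)"
      by (simp add: matrix_vector_mult_diff_rdistrib col_proj_mult_vec)
    have Qx: "Q k \<bullet> (?D *v x) = (if k \<le> s then 0 else Q k \<bullet> x)" if k: "k \<in> {1..?q}" for k
    proof (cases "k \<le> s")
      case True
      then have "Q k \<bullet> (\<Sum>j=1..s. (Q j \<bullet> x) *\<^sub>R Q j) = Q k \<bullet> x"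
        using k by (intro orthonormal_family_inner_sum[OF PQs(2)]) auto
      with True show ?thesis
        by (simp add: fixed inner_diff_right)
    next
      case False
      then have "Q k \<bullet> Q j = 0" if "j \<in> {1..s}" for j
        using k that s PQ(2) by (auto simp: orthonormal_family_def)
      then show ?thesis
        using False by (simp add: fixed inner_diff_right inner_sum_right)
    qed
    have BD: "B *v (?D *v x) = ?tail *v x"
      unfolding B sum_split svd_tail_def
      using Qx s by (simp add: matrix_vector_mult_add_rdistrib sum_matrix_vec_mult outer_mult_vec
          scaleR_matrix_vector_assoc[symmetric])
    have "P j \<bullet> (?tail *v x) = 0" if j: "j \<in> {1..s}" for j
    proof -
      have "P j \<bullet> P k = 0" if "k \<in> {s+1..?q}" for k
        using j that s PQ(1) by (auto simp: orthonormal_family_def)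
      then show ?thesis
        by (simp add: svd_tail_def sum_matrix_vec_mult outer_mult_vec inner_sum_right
            scaleR_matrix_vector_assoc[symmetric])
    qed
    then have "?C *v (?tail *v x) = ?tail *v x"
      by (simp add: matrix_vector_mult_diff_rdistrib col_proj_mult_vec)
    then show "(?C ** B ** ?D) *v x = ?tail *v x"
      by (simp add: matrix_vector_mul_assoc[symmetric] BD)
  qed
  have "?E \<bullet> (B' - B) + Omega_minus s P Q (B' - B) + ?E \<bullet> B + W \<bullet> ?tail
      = ?E \<bullet> B' + W \<bullet> (?C ** B' ** ?D)"
    unfolding W(2)[symmetric] block[symmetric]
    by (simp add: matrix_mult_diff_distrib_both inner_diff_right)
  \<comment> \<open>Adjointness moves the compressions onto \<open>W\<close>, giving the contraction
    of \<open>contractive_block_sum\<close>.\<close>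
  also have "\<dots> = (?E + ?C ** W ** ?D) \<bullet> B'"
    by (simp add: inner_add_left inner_matrix_mult_right[of W]
        inner_matrix_mult_left[of "W ** _"] transpose_mat_1_minus_col_proj matrix_mul_assoc)
  also have "\<dots> \<le> nuclear_norm B'"
    by (intro inner_le_nuclear_norm[OF dims] contractive_block_sum PQs W)
  finally have lower: "?E \<bullet> (B' - B) + Omega_minus s P Q (B' - B) + ?E \<bullet> B + W \<bullet> ?tail
    \<le> nuclear_norm B'" .
  have EB: "?E \<bullet> B = (\<Sum>k=1..s. \<Lambda> k)"
    using inner_partial_isometry[OF PQ, of "{1..s}" "{1..?q}" \<Lambda>] s B by (simp add: Int_absorb2)
  \<comment> \<open>First of the two copies of the tail norm: \<open>W\<close> was chosen for the
    difference and may pair negatively with the tail.\<close>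
  have "- W \<bullet> ?tail \<le> nuclear_norm ?tail"
  proof (rule inner_le_nuclear_norm[OF dims])
    show "contractive (- W)"
      unfolding contractive_def
    proof (intro allI)
      fix u v
      have "(- u) \<bullet> (W *v v) \<le> norm (- u) * norm v"
        using W(1) unfolding contractive_def by blast
      moreover have "u \<bullet> ((- W) *v v) = (- u) \<bullet> (W *v v)"
        by (simp add: matrix_vector_mult_def inner_vec_def sum_negf)
      ultimately show "u \<bullet> ((- W) *v v) \<le> norm u * norm v" by simp
    qed
  qed
  \<comment> \<open>Second copy: the trailing singular values of \<open>B\<close>.\<close>
  moreover have "(\<Sum>k=s+1..?q. \<Lambda> k) \<le> nuclear_norm ?tail"
  proof -
    have tail: "{s+1..?q} \<subseteq> {1..?q}" by auto
    have "partial_isometry {s+1..?q} P Q \<bullet> ?tail \<le> nuclear_norm ?tail"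
      using PQ tail
      by (intro inner_le_nuclear_norm[OF dims] contractive_partial_isometry)
        (auto intro: orthonormal_family_subset)
    then show ?thesis
      using inner_partial_isometry[OF PQ _ tail tail, of \<Lambda>] by (simp add: svd_tail_def)
  qed
  moreover have "nuclear_norm B \<le> (\<Sum>k=1..s. \<Lambda> k) + (\<Sum>k=s+1..?q. \<Lambda> k)"
    using nuclear_norm_le_svd_sum[OF dims svd] sum_split[of \<Lambda>] by linarith
  \<comment> \<open>The third summand of \<open>Omega_plus\<close> already dominates.\<close>
  moreover have "- (?E \<bullet> (B' - B)) \<le> Omega_plus s P Q (B' - B)"
  proof -
    have "- (?E \<bullet> (B' - B)) \<le> sqrt (real s) * norm (col_proj s P ** (B' - B) ** col_proj s Q)"
      using inner_partial_isometry_le_norm[OF PQs, of "B' - B"] by linarith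
    also have "\<dots> \<le> Omega_plus s P Q (B' - B)"
      unfolding Omega_plus_def by (intro mult_left_mono) auto
    finally show ?thesis .
  qed
  ultimately show ?thesis
    using lower EB by simp
qed

section \<open>Young's inequality and the oracle bounds\<close>

lemma convex_conjugate_ge:
  "0 \<le> u \<Longrightarrow> ereal (u * v - G u) \<le> convex_conjugate G v"
  unfolding convex_conjugate_def by (rule SUP_upper) simp

theorem theorem3p2:
  fixes M :: "'w measure"
    and X :: "nat \<Rightarrow> 'w \<Rightarrow> real ^ 'p ^ 'q"
    and Y :: "nat \<Rightarrow> 'w \<Rightarrow> real"
    and n s :: nat
    and \<rho> G :: "real \<Rightarrow> real"
    and \<eta> L lam lam_eps lam_star \<delta> :: real
    and B0 B Bhat :: "real ^ 'q ^ 'p"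
    and P :: "nat \<Rightarrow> real ^ 'p" and \<Lambda> :: "nat \<Rightarrow> real" and Q :: "nat \<Rightarrow> real ^ 'q"
    and \<omega> :: 'w
  assumes dims: "CARD('q) \<le> CARD('p)"
    and eta: "\<eta> > 0"
    and n_pos: "n \<ge> 1"
    and prob: "prob_space M"
    and X_meas: "\<And>i. i \<in> {1..n} \<Longrightarrow> X i \<in> borel_measurable M"
    and Y_meas: "\<And>i. i \<in> {1..n} \<Longrightarrow> Y i \<in> borel_measurable M"
    and X_mask: "\<And>i \<omega>'. i \<in> {1..n} \<Longrightarrow> \<omega>' \<in> space M \<Longrightarrow> X i \<omega>' \<in> mask_set"
    and rho_convex: "convex_on UNIV \<rho>"
    and rho_lipschitz: "\<And>x y. \<bar>\<rho> x - \<rho> y\<bar> \<le> L * \<bar>x - y\<bar>"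
    and risk_finite:
      "\<And>B'. B' \<in> max_ball \<eta> \<Longrightarrow> integrable M (\<lambda>\<omega>'. empirical_risk \<rho> n X Y \<omega>' B')"
    and B0_min: "is_arg_min (risk M \<rho> n X Y) (\<lambda>B'. B' \<in> max_ball \<eta>) B0"
    and G_increasing: "mono_on {0..} G"
    and G_strictly_convex: "strictly_convex_on {0..} G"
    and G_zero: "G 0 = 0"
    and margin: "\<And>B'. B' \<in> max_ball \<eta> \<Longrightarrow>
      risk M \<rho> n X Y B' - risk M \<rho> n X Y B0 \<ge> G (norm (B' - B0))"
    and B_mem: "B \<in> max_ball \<eta>"
    and s_range: "1 \<le> s" "s \<le> CARD('q)"
    and svd: "is_svd B P \<Lambda> Q"
    and sample: "\<omega> \<in> space M"
    and lambda_eps_pos: "lam_eps > 0"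
    and lambda_star_pos: "lam_star > 0"
    and noise: "\<And>B'. B' \<in> max_ball \<eta> \<Longrightarrow>
      \<bar>(empirical_risk \<rho> n X Y \<omega> B' - risk M \<rho> n X Y B')
        - (empirical_risk \<rho> n X Y \<omega> B - risk M \<rho> n X Y B)\<bar>
      \<le> lam_eps * Omega_under s P Q (B' - B) + lam_star"
    and delta: "0 < \<delta>" "\<delta> < 1"
    and lambda: "lam > lam_eps"
    and Bhat_min: "is_arg_min (\<lambda>B'. empirical_risk \<rho> n X Y \<omega> B' + lam * nuclear_norm B')
      (\<lambda>B'. B' \<in> max_ball \<eta>) Bhat"
  shows "ereal (\<delta> * (lam - lam_eps) * Omega_under s P Q (Bhat - B))
      \<le> 2 * convex_conjugate G (3 * (lam + lam_eps) * (1 + \<delta>) * sqrt (real s))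
        + ereal (2 * (lam_star + risk M \<rho> n X Y B - risk M \<rho> n X Y B0)
            + 4 * lam * nuclear_norm (svd_tail s P \<Lambda> Q))
    \<and> ereal (risk M \<rho> n X Y Bhat - risk M \<rho> n X Y B)
      \<le> ereal (1 / \<delta>) *
          (2 * convex_conjugate G (3 * (lam + lam_eps) * (1 + \<delta>) * sqrt (real s))
            + ereal (lam_star + 2 * (risk M \<rho> n X Y B - risk M \<rho> n X Y B0)
                + 2 * lam * nuclear_norm (svd_tail s P \<Lambda> Q)))
        + ereal (lam_star + 2 * lam * nuclear_norm (svd_tail s P \<Lambda> Q))"
proof -
  let ?R = "risk M \<rho> n X Y" and ?Rn = "empirical_risk \<rho> n X Y \<omega>"
  let ?T = "nuclear_norm (svd_tail s P \<Lambda> Q)"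
  let ?Op = "Omega_plus s P Q (Bhat - B)" and ?Om = "Omega_minus s P Q (Bhat - B)"
  \<comment> \<open>The factor \<open>3 * sqrt (real s)\<close> comes from
    \<open>Omega_plus_le\<close>, and \<open>1 + \<delta>\<close> from the multiple of
    \<open>Omega_plus\<close> added to both sides.\<close>
  define v where "v = 3 * (lam + lam_eps) * (1 + \<delta>) * sqrt (real s)"
  have v_nonneg: "0 \<le> v"
    using lambda_eps_pos lambda delta by (simp add: v_def)
  have PQ: "orthonormal_family {1..s} P" "orthonormal_family {1..s} Q"
    using svd s_range by (auto simp: is_svd_def intro: orthonormal_family_subset)
  have Bhat: "Bhat \<in> max_ball \<eta>"
    and basic: "?Rn Bhat + lam * nuclear_norm Bhat \<le> ?Rn B + lam * nuclear_norm B"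
    using Bhat_min B_mem by (auto simp: is_arg_min_linorder)
  have "lam * (nuclear_norm B - nuclear_norm Bhat) \<le> lam * (?Op - ?Om + 2 * ?T)"
    using nuclear_norm_diff_le[OF dims s_range(2) svd] lambda lambda_eps_pos
    by (intro mult_left_mono) auto
  \<comment> \<open>The noise raises the coefficient of \<open>Omega_plus\<close> and lowers that of
    \<open>Omega_minus\<close> by \<open>lam_eps\<close>.\<close>
  with basic noise[OF Bhat]
  have excess: "?R Bhat - ?R B + (lam - lam_eps) * ?Om
      \<le> (lam + lam_eps) * ?Op + lam_star + 2 * lam * ?T"
    by (simp add: Omega_under_def algebra_simps)
  have Op_nonneg: "0 \<le> ?Op"
    by (simp add: Omega_plus_def)
  have T_nonneg: "0 \<le> ?T" and Om_nonneg: "0 \<le> ?Om"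
    unfolding Omega_minus_def by (rule nuclear_norm_nonneg[OF dims])+
  have "(1 + \<delta>) * (lam + lam_eps) * ?Op
      \<le> (1 + \<delta>) * (lam + lam_eps) * (3 * sqrt (real s) * norm (Bhat - B))"
    using Omega_plus_le[OF PQ] lambda lambda_eps_pos delta by (intro mult_left_mono) auto
  also have "\<dots> = v * norm (Bhat - B)"
    by (simp add: v_def mult_ac)
  \<comment> \<open>The margin condition is centred at \<open>B0\<close>, hence the detour.\<close>
  also have "\<dots> \<le> v * (norm (Bhat - B0) + norm (B - B0))"
    using norm_triangle_ineq4[of "Bhat - B0" "B - B0"] v_nonneg by (intro mult_left_mono) auto
  finally have Op_le: "(1 + \<delta>) * (lam + lam_eps) * ?Op
      \<le> v * norm (Bhat - B0) + v * norm (B - B0)"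
    by (simp add: distrib_left)
  \<comment> \<open>Testing the supremum at 0 rules out minus infinity.\<close>
  have "0 \<le> convex_conjugate G v"
    using convex_conjugate_ge[of 0 v G] G_zero by (simp add: zero_ereal_def)
  then consider "convex_conjugate G v = \<infinity>" | h where "convex_conjugate G v = ereal h"
    by (cases "convex_conjugate G v") auto
  then show ?thesis
  proof cases
    \<comment> \<open>Both right-hand sides are infinite, as \<open>1 / \<delta>\<close> is
      positive.\<close>
    case 1
    then show ?thesis
      unfolding v_def[symmetric] using delta by simp
  next
    case (2 h)
    have young: "v * norm (B' - B0) \<le> h + (?R B' - ?R B0)" if "B' \<in> max_ball \<eta>" for B'
      using convex_conjugate_ge[of "norm (B' - B0)" v G] margin[OF that]
      by (simp add: 2 mult.commute)
    define K where "K = 2 * h + lam_star + 2 * (?R B - ?R B0) + 2 * lam * ?T"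
    \<comment> \<open>The risk of \<open>Bhat\<close> cancels: Young's inequality at
      \<open>Bhat\<close> and \<open>B\<close> leaves twice the excess risk of
      \<open>B\<close>.\<close>
    have key: "(lam - lam_eps) * ?Om + \<delta> * ((lam + lam_eps) * ?Op) \<le> K"
      using excess Op_le young[OF Bhat] young[OF B_mem] by (simp add: K_def algebra_simps)
    have "\<delta> * (lam - lam_eps) * ?Om \<le> 1 * (lam - lam_eps) * ?Om"
      using delta lambda Om_nonneg by (intro mult_right_mono) auto
    moreover have "\<delta> * (lam - lam_eps) * ?Op \<le> \<delta> * (lam + lam_eps) * ?Op"
      using delta lambda_eps_pos Op_nonneg by (intro mult_right_mono mult_left_mono) auto
    ultimately have "\<delta> * (lam - lam_eps) * (?Op + ?Om) \<le> K"
      using key by (simp add: algebra_simps)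
    \<comment> \<open>The first claim has an extra \<open>lam_star\<close> and twice the tail term
      of \<open>K\<close>, both nonnegative additions.\<close>
    moreover have "0 \<le> lam * ?T"
      using T_nonneg lambda lambda_eps_pos by simp
    ultimately have first: "\<delta> * (lam - lam_eps) * Omega_under s P Q (Bhat - B)
        \<le> 2 * h + (2 * (lam_star + ?R B - ?R B0) + 4 * lam * ?T)"
      using lambda_star_pos by (simp add: Omega_under_def K_def)
    have Om': "0 \<le> (lam - lam_eps) * ?Om"
      using Om_nonneg lambda by simp
    \<comment> \<open>For the second claim \<open>key\<close> bounds the \<open>Omega_plus\<close>
      term of \<open>excess\<close> itself.\<close>
    then have "(lam + lam_eps) * ?Op \<le> 1 / \<delta> * K"
      using key delta by (simp add: field_simps)
    then have second: "?R Bhat - ?R B \<le> 1 / \<delta> * (2 * h + (lam_star + 2 * (?R B - ?R B0) + 2 * lam * ?T))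
        + (lam_star + 2 * lam * ?T)"
      using excess Om' by (simp add: K_def add.assoc)
    have "2 * convex_conjugate G v = ereal (2 * h)"
      by (simp add: 2 numeral_eq_ereal)
    with first second show ?thesis
      unfolding v_def[symmetric] by simp
  qed
qed

end
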